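(* Let $\xi\in[0,1)$. Then there exists an instance of the recursion $$z_{k+1}=(I+\alpha_kH_k)z_k+\sqrt{\alpha_k}\,\chi_k,\qquad H_k=H+\frac{\xi}{2\alpha(k+K)^{1-\xi}}I,\qquad \alpha_k=\frac{\alpha}{(k+K)^\xi},$$ (with $H$ Hurwitz, $\{\chi_k\}$ i.i.d. zero-mean with bounded third moment, $z_0$ independent of $\{\chi_k\}$, $\alpha>0$, $K\ge 2$, and $\alpha_k\le1$) and a constant $c>0$ such that for all $k\ge0$, $$d_{\mathcal W}\big(z_k,(\Sigma_k^{(\alpha,\xi)})^{1/2}Z\big)\ge c\,\sqrt{\alpha_k},$$ where $\Sigma_k^{(\alpha,\xi)}$ is the covariance of $z_k$ and $Z$ is a standard Gaussian vector. For $\xi=0$ (where $\alpha_k\equiv\alpha$), $H$, the laws of $\chi_0$ and $z_0$, and the constant $c$ can be chosen independently of $\alpha$, the bound holding for all sufficiently small $\alpha>0$.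
   Context: $d_{\mathcal W}(X,Y)=\inf\mathbb E\|X-Y\|$ over all couplings of the laws of $X,Y$ (Wasserstein-1 distance, Euclidean norm). A square matrix is Hurwitz if all its eigenvalues have negative real part. *)

theory Defs
  imports "HOL-Probability.Probability"
begin

definition couplings :: "('a::topological_space) measure \<Rightarrow> 'a measure \<Rightarrow> ('a \<times> 'a) measure set" where
  "couplings \<mu> \<nu> = {\<pi>. sets \<pi> = sets (borel \<Otimes>\<^sub>M borel) \<and> distr \<pi> borel fst = \<mu> \<and> distr \<pi> borel snd = \<nu>}"

text \<open>The Wasserstein-1 distance is taken in \<^typ>\<open>ennreal\<close>, so it needs no moment conditions to be
  meaningful. The norm of \<^typ>\<open>real^'n\<close> is the Euclidean one.\<close>

definition wasserstein1 :: "('a::real_normed_vector) measure \<Rightarrow> 'a measure \<Rightarrow> ennreal" where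
  "wasserstein1 \<mu> \<nu> = (INF \<pi> \<in> couplings \<mu> \<nu>. \<integral>\<^sup>+ p. ennreal (norm (fst p - snd p)) \<partial>\<pi>)"

definition hurwitz :: "real^'n^'n \<Rightarrow> bool" where
  "hurwitz A \<longleftrightarrow>
     (\<forall>(l::complex) (v::complex^'n). v \<noteq> 0 \<and> (\<chi> i j. complex_of_real (A $ i $ j)) *v v = l *s v \<longrightarrow> Re l < 0)"

definition psd_matrix :: "real^'n^'n \<Rightarrow> bool" where
  "psd_matrix S \<longleftrightarrow> transpose S = S \<and> (\<forall>x. 0 \<le> x \<bullet> (S *v x))"

text \<open>The principal square root; meaningful for positive semidefinite arguments, where it is unique.\<close>

definition psd_sqrt :: "real^'n^'n \<Rightarrow> real^'n^'n" where
  "psd_sqrt A = (THE S. psd_matrix S \<and> S ** S = A)"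

definition covariance_matrix :: "'w measure \<Rightarrow> ('w \<Rightarrow> real^'n) \<Rightarrow> real^'n^'n" where
  "covariance_matrix M X =
     (\<chi> i j. \<integral>\<omega>. (X \<omega> $ i - (\<integral>\<eta>. X \<eta> $ i \<partial>M)) * (X \<omega> $ j - (\<integral>\<eta>. X \<eta> $ j \<partial>M)) \<partial>M)"

text \<open>The law of a vector with independent standard normal coordinates.\<close>

definition std_gaussian :: "(real^'n) measure" where
  "std_gaussian = distr (\<Pi>\<^sub>M i\<in>(UNIV::'n set). density lborel (\<lambda>x. ennreal (std_normal_density x)))
     borel (\<lambda>f. \<chi> i. f i)"

definition step_size :: "real \<Rightarrow> real \<Rightarrow> nat \<Rightarrow> nat \<Rightarrow> real" where
  "step_size \<xi> \<alpha> K k = \<alpha> / real (k + K) powr \<xi>"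

definition drift_matrix :: "real \<Rightarrow> real \<Rightarrow> nat \<Rightarrow> real^'n^'n \<Rightarrow> nat \<Rightarrow> real^'n^'n" where
  "drift_matrix \<xi> \<alpha> K H k = H + (\<xi> / (2 * \<alpha> * real (k + K) powr (1 - \<xi>))) *\<^sub>R mat 1"

primrec iterate ::
  "real \<Rightarrow> real \<Rightarrow> nat \<Rightarrow> real^'n^'n \<Rightarrow> (nat \<Rightarrow> 'w \<Rightarrow> real^'n) \<Rightarrow> ('w \<Rightarrow> real^'n) \<Rightarrow> nat \<Rightarrow> 'w \<Rightarrow> real^'n" where
  "iterate \<xi> \<alpha> K H X z0 0 = z0"
| "iterate \<xi> \<alpha> K H X z0 (Suc k) = (\<lambda>\<omega>.
     (mat 1 + step_size \<xi> \<alpha> K k *\<^sub>R drift_matrix \<xi> \<alpha> K H k) *v iterate \<xi> \<alpha> K H X z0 k \<omega>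
       + sqrt (step_size \<xi> \<alpha> K k) *\<^sub>R X k \<omega>)"

text \<open>Mutual independence of the family \<open>z0, X 0, X 1, \<dots>\<close> says that the \<open>X k\<close> are independent and that
  \<open>z0\<close> is independent of the whole sequence. The last conjunct makes the covariances of the iterates exist.\<close>

definition recursion_instance ::
  "'w measure \<Rightarrow> real \<Rightarrow> real \<Rightarrow> nat \<Rightarrow> real^'n^'n \<Rightarrow> (nat \<Rightarrow> 'w \<Rightarrow> real^'n) \<Rightarrow> ('w \<Rightarrow> real^'n) \<Rightarrow> bool" where
  "recursion_instance M \<xi> \<alpha> K H X z0 \<longleftrightarrow>
     prob_space M \<and> hurwitz H \<and> 0 < \<alpha> \<and> 2 \<le> K \<and> (\<forall>k. step_size \<xi> \<alpha> K k \<le> 1) \<and>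
     prob_space.indep_vars M (\<lambda>_. borel) (case_nat z0 X) UNIV \<and>
     (\<forall>k. distr M borel (X k) = distr M borel (X 0)) \<and>
     (\<integral>\<omega>. X 0 \<omega> \<partial>M) = 0 \<and> integrable M (\<lambda>\<omega>. norm (X 0 \<omega>) ^ 3) \<and>
     integrable M (\<lambda>\<omega>. norm (z0 \<omega>) ^ 2)"

definition gaussian_distance ::
  "'w measure \<Rightarrow> real \<Rightarrow> real \<Rightarrow> nat \<Rightarrow> real^'n^'n \<Rightarrow> (nat \<Rightarrow> 'w \<Rightarrow> real^'n) \<Rightarrow> ('w \<Rightarrow> real^'n) \<Rightarrow> nat \<Rightarrow> ennreal" where
  "gaussian_distance M \<xi> \<alpha> K H X z0 k =
     (let z = iterate \<xi> \<alpha> K H X z0 k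
      in wasserstein1 (distr M borel z)
           (distr std_gaussian borel (\<lambda>x. psd_sqrt (covariance_matrix M z) *v x)))"

end

theory Submission
  imports Defs
begin

text \<open>
  Take \<open>H = -I\<close>, and let \<open>z0\<close> and the \<open>X k\<close> be i.i.d. copies of \<open>N - 1\<close> along one coordinate axis, with \<open>N\<close>
  Poisson of rate 1. Along this axis \<open>z\<close> at time \<open>k\<close> is a weighted sum of independent copies of
  \<open>N - 1\<close>, whose characteristic function is \<open>exp ((cos t - 1) + \<i> (sin t - t))\<close>. All the phases
  \<open>sin t - t\<close> have the same sign and are of cubic size, so for \<open>0 \<le> t \<le> 1\<close> the characteristic function of
  the iterate is \<open>exp (- u - \<i> v)\<close> with \<open>0 \<le> u \<le> 2 t\<^sup>2\<close> and \<open>sqrt (\<alpha> k) t\<^sup>3 / 21 \<le> v \<le> 2 t\<^sup>2\<close>.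
  The phase survives in the limit because every step multiplies it by at least \<open>(1 - \<alpha> k)\<^sup>3\<close> and adds
  at least \<open>(\<alpha> k)\<^bsup>3/2\<^esup> t\<^sup>3 / 7\<close>. A centred Gaussian, whatever its covariance, has a real
  characteristic function, and \<open>x \<mapsto> sin (t x)\<close> is 1-Lipschitz, so the Wasserstein distance is at
  least \<open>exp (- u) sin v\<close> at \<open>t = 1/2\<close>.
\<close>

section \<open>Lower bounds for the Wasserstein distance\<close>

text \<open>The easy half of Kantorovich-Rubinstein duality: under any coupling the difference of
  the integrals is the mean of \<open>f (fst p) - f (snd p)\<close>, which the transport cost
  dominates. Boundedness makes \<open>f\<close> integrable without moment conditions.\<close>

lemma wasserstein1_ge_integral_diff:
  fixes \<mu> \<nu> :: "'a::{real_normed_vector, second_countable_topology} measure" and f :: "'a \<Rightarrow> real"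
  assumes \<mu>: "prob_space \<mu>" and f [measurable]: "f \<in> borel_measurable borel"
    and bounded: "\<And>x. \<bar>f x\<bar> \<le> B" and lipschitz: "\<And>x y. \<bar>f x - f y\<bar> \<le> norm (x - y)"
  shows "ennreal \<bar>(\<integral>x. f x \<partial>\<mu>) - (\<integral>x. f x \<partial>\<nu>)\<bar> \<le> wasserstein1 \<mu> \<nu>"
  unfolding wasserstein1_def
proof (rule INF_greatest)
  fix \<pi> :: "('a \<times> 'a) measure" assume "\<pi> \<in> couplings \<mu> \<nu>"
  then have sets [measurable_cong]: "sets \<pi> = sets (borel \<Otimes>\<^sub>M borel)"
    and fst: "distr \<pi> borel fst = \<mu>" and snd: "distr \<pi> borel snd = \<nu>"
    by (auto simp: couplings_def)
  interpret \<pi>: prob_space \<pi>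
    using \<mu> fst prob_space_distrD[of fst \<pi> borel] by simp
  have int: "integrable \<pi> (\<lambda>p. f (fst p))" "integrable \<pi> (\<lambda>p. f (snd p))"
    by (rule \<pi>.integrable_const_bound[where B=B]; use bounded in \<open>simp; measurable\<close>)+
  have "(\<integral>x. f x \<partial>\<mu>) - (\<integral>x. f x \<partial>\<nu>) = (\<integral>p. f (fst p) - f (snd p) \<partial>\<pi>)"
    using int by (simp add: fst[symmetric] snd[symmetric] integral_distr)
  then have "ennreal \<bar>(\<integral>x. f x \<partial>\<mu>) - (\<integral>x. f x \<partial>\<nu>)\<bar>
      = ennreal (norm (\<integral>p. f (fst p) - f (snd p) \<partial>\<pi>))"
    by simp
  also have "\<dots> \<le> (\<integral>\<^sup>+p. ennreal (norm (f (fst p) - f (snd p))) \<partial>\<pi>)"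
    by (intro integral_norm_bound_ennreal Bochner_Integration.integrable_diff int)
  also have "\<dots> \<le> (\<integral>\<^sup>+p. ennreal (norm (fst p - snd p)) \<partial>\<pi>)"
    by (intro nn_integral_mono ennreal_leI) (simp add: lipschitz)
  finally show "ennreal \<bar>(\<integral>x. f x \<partial>\<mu>) - (\<integral>x. f x \<partial>\<nu>)\<bar>
      \<le> (\<integral>\<^sup>+p. ennreal (norm (fst p - snd p)) \<partial>\<pi>)" .
qed

lemma Im_char_distr:
  assumes "prob_space M" and [measurable]: "f \<in> borel_measurable M"
  shows "Im (char (distr M borel f) t) = (\<integral>x. sin (t * f x) \<partial>M)"
proof -
  interpret prob_space M by fact
  have "integrable M (\<lambda>x. iexp (t * f x))"
    by (rule integrable_const_bound[where B=1]) auto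
  then have "Im (\<integral>x. iexp (t * f x) \<partial>M) = (\<integral>x. Im (iexp (t * f x)) \<partial>M)"
    by (rule integral_Im[symmetric])
  then show ?thesis
    by (simp add: char_def integral_distr Im_exp)
qed

text \<open>The test function is \<open>sin (t * x $ i)\<close>: it is bounded by 1, it is
  1-Lipschitz because \<open>t\<close> is at most 1 in modulus, and its mean is the imaginary part
  of the characteristic function of coordinate \<open>i\<close>.\<close>

lemma wasserstein1_ge_Im_char:
  fixes \<mu> \<nu> :: "(real^'n) measure"
  assumes "prob_space \<mu>" "prob_space \<nu>" and sets: "sets \<mu> = sets borel" "sets \<nu> = sets borel"
    and t: "\<bar>t\<bar> \<le> 1"
  shows "ennreal \<bar>Im (char (distr \<mu> borel (\<lambda>x. x $ i)) t) - Im (char (distr \<nu> borel (\<lambda>x. x $ i)) t)\<bar>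
    \<le> wasserstein1 \<mu> \<nu>"
proof -
  have [measurable]: "(\<lambda>x. x $ i) \<in> borel_measurable \<mu>" "(\<lambda>x. x $ i) \<in> borel_measurable \<nu>"
    using sets by (auto cong: measurable_cong_sets)
  have sin_le: "\<bar>sin a - sin b\<bar> \<le> \<bar>a - b\<bar>" for a b :: real
  proof -
    have "\<bar>sin a - sin b\<bar> = 2 * \<bar>sin ((a - b) / 2)\<bar> * \<bar>cos ((a + b) / 2)\<bar>"
      by (simp add: sin_diff_sin abs_mult)
    also have "\<dots> \<le> 2 * \<bar>(a - b) / 2\<bar> * 1"
      by (intro mult_mono abs_sin_x_le_abs_x) auto
    finally show ?thesis by simp
  qed
  have "\<bar>sin (t * x $ i) - sin (t * y $ i)\<bar> \<le> norm (x - y)" for x y :: "real^'n"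
  proof -
    have "\<bar>sin (t * x $ i) - sin (t * y $ i)\<bar> \<le> \<bar>t\<bar> * \<bar>(x - y) $ i\<bar>"
      using sin_le[of "t * x $ i" "t * y $ i"]
      by (simp add: abs_mult[symmetric] right_diff_distrib)
    also have "\<dots> \<le> 1 * norm (x - y)"
      using t by (intro mult_mono component_le_norm_cart) auto
    finally show ?thesis by simp
  qed
  then show ?thesis
    using assms wasserstein1_ge_integral_diff[of \<mu> "\<lambda>x. sin (t * x $ i)" 1 \<nu>]
    by (simp add: Im_char_distr)
qed

section \<open>Independent coordinates of a product measure\<close>

text \<open>The joint law of the coordinates is the product measure itself and each marginal is its
  factor, so the joint law is the product of the marginals.\<close>

lemma indep_vars_PiM_component:
  assumes N: "\<And>i. i \<in> I \<Longrightarrow> prob_space (N i)" and I: "I \<noteq> {}"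
  shows "prob_space.indep_vars (PiM I N) N (\<lambda>i \<omega>. \<omega> i) I"
proof -
  interpret prob_space "PiM I N" by (rule prob_space_PiM) (rule N)
  have "distr (PiM I N) (PiM I N) (\<lambda>\<omega>. \<lambda>i\<in>I. \<omega> i) = distr (PiM I N) (PiM I N) (\<lambda>\<omega>. \<omega>)"
    by (intro distr_cong refl) (simp add: space_PiM PiE_restrict)
  also have "\<dots> = (\<Pi>\<^sub>M i\<in>I. distr (PiM I N) (N i) (\<lambda>\<omega>. \<omega> i))"
    by (simp add: distr_id2) (intro PiM_cong refl distr_PiM_component[symmetric] N)
  finally show ?thesis
    using I by (subst indep_vars_iff_distr_eq_PiM') auto
qed

text \<open>Independence turns the sum into a product, and each weight moves into the argument. It
  serves both sides of the comparison: components of a linear image of the Gaussian, and components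
  of the iterates.\<close>

lemma char_weighted_sum_PiM:
  fixes w :: "'i \<Rightarrow> real" and f :: "'a \<Rightarrow> real"
  assumes N: "prob_space N" and f [measurable]: "f \<in> borel_measurable N" and J: "J \<subseteq> I" "I \<noteq> {}"
  shows "char (distr (PiM I (\<lambda>_. N)) borel (\<lambda>\<omega>. \<Sum>j\<in>J. w j * f (\<omega> j))) t
    = (\<Prod>j\<in>J. char (distr N borel f) (w j * t))"
proof -
  interpret P: prob_space "PiM I (\<lambda>_. N)" by (rule prob_space_PiM) (rule N)
  have "P.indep_vars (\<lambda>_. N) (\<lambda>i \<omega>. \<omega> i) I"
    using N J by (intro indep_vars_PiM_component)
  then have "P.indep_vars (\<lambda>_. N) (\<lambda>i \<omega>. \<omega> i) J"
    using J(1) by (rule P.indep_vars_subset)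
  then have "P.indep_vars (\<lambda>_. borel) (\<lambda>j \<omega>. w j * f (\<omega> j)) J"
    by (rule P.indep_vars_compose2) simp
  then have "char (distr (PiM I (\<lambda>_. N)) borel (\<lambda>\<omega>. \<Sum>j\<in>J. w j * f (\<omega> j))) t
    = (\<Prod>j\<in>J. char (distr (PiM I (\<lambda>_. N)) borel (\<lambda>\<omega>. w j * f (\<omega> j))) t)"
    by (rule P.char_distr_sum[where X="\<lambda>j \<omega>. w j * f (\<omega> j)"])
  also have "\<dots> = (\<Prod>j\<in>J. char (distr N borel f) (w j * t))"
  proof (rule prod.cong[OF refl])
    fix j assume "j \<in> J"
    with J have j: "j \<in> I" by auto
    have "distr (PiM I (\<lambda>_. N)) borel (\<lambda>\<omega>. w j * f (\<omega> j))
        = distr (distr (PiM I (\<lambda>_. N)) N (\<lambda>\<omega>. \<omega> j)) borel (\<lambda>x. w j * f x)"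
      using j by (subst distr_distr) (auto simp: comp_def)
    also have "\<dots> = distr N borel (\<lambda>x. w j * f x)"
      using distr_PiM_component[of I "\<lambda>_. N" j] N j by simp
    finally have "char (distr (PiM I (\<lambda>_. N)) borel (\<lambda>\<omega>. w j * f (\<omega> j))) t
        = (\<integral>x. iexp (t * (w j * f x)) \<partial>N)"
      by (simp add: char_def integral_distr)
    also have "\<dots> = (\<integral>x. iexp ((w j * t) * f x) \<partial>N)"
      by (simp only: mult.assoc mult.left_commute)
    finally show "char (distr (PiM I (\<lambda>_. N)) borel (\<lambda>\<omega>. w j * f (\<omega> j))) t
        = char (distr N borel f) (w j * t)"
      by (simp add: char_def integral_distr)
  qed
  finally show ?thesis .
qed

section \<open>The Gaussian side\<close>

lemma prob_space_std_normal: "prob_space (density lborel (\<lambda>x. ennreal (std_normal_density x)))"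
  by (rule prob_space_normal_density) simp


lemma measurable_vec_lambda_PiM [measurable]:
  "(\<lambda>f. \<chi> i. f i) \<in> (\<Pi>\<^sub>M i\<in>(UNIV::'n::finite set). density lborel (\<lambda>x. ennreal (std_normal_density x)))
    \<rightarrow>\<^sub>M borel"
  by (subst borel_measurable_euclidean_space) (auto simp: Basis_vec_def inner_axis)

lemma prob_space_std_gaussian: "prob_space (std_gaussian :: (real^'n) measure)"
  unfolding std_gaussian_def
  by (intro prob_space.prob_space_distr prob_space_PiM prob_space_std_normal measurable_vec_lambda_PiM)

lemma borel_measurable_matrix_vector_mult [measurable]:
  "(\<lambda>x. (A :: real^'n^'m) *v x) \<in> borel_measurable borel"
  by (intro borel_measurable_continuous_onI linear_continuous_on)
     (simp add: linear_linear matrix_vector_mul_linear)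

lemma borel_measurable_vec_nth [measurable]: "(\<lambda>x. (x :: real^'n) $ i) \<in> borel_measurable borel"
  by (intro borel_measurable_continuous_onI continuous_intros)

text \<open>A component of \<open>A *v x\<close> is a weighted sum of independent standard normals,
  whose characteristic functions are real. Since \<open>A\<close> is arbitrary, the square root of
  the covariance never has to be computed.\<close>

lemma Im_char_gaussian_component:
  fixes A :: "real^'n^'n"
  shows "Im (char (distr (distr std_gaussian borel (\<lambda>x. A *v x)) borel (\<lambda>x. x $ i)) t) = 0"
proof -
  let ?N = "density lborel (\<lambda>x. ennreal (std_normal_density x))"
  have "distr (distr std_gaussian borel (\<lambda>x. A *v x)) borel (\<lambda>x. x $ i)
      = distr (PiM (UNIV :: 'n set) (\<lambda>_. ?N)) borel (\<lambda>\<omega>. \<Sum>j\<in>UNIV. A $ i $ j * \<omega> j)"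
    unfolding std_gaussian_def
    by (subst distr_distr, simp, simp, subst distr_distr)
       (auto simp: comp_def matrix_vector_mult_def)
  also have "char \<dots> t = (\<Prod>j\<in>UNIV. char (distr ?N borel (\<lambda>x. x)) (A $ i $ j * t))"
    by (rule char_weighted_sum_PiM) (auto intro: prob_space_std_normal)
  also have "distr ?N borel (\<lambda>x. x) = ?N"
    by (intro distr_id2) auto
  also have "(\<Prod>j\<in>UNIV. char ?N (A $ i $ j * t))
      = complex_of_real (\<Prod>j\<in>UNIV. exp (- (A $ i $ j * t)\<^sup>2 / 2))"
    by (simp add: char_std_normal_distribution)
  finally show ?thesis by (simp only: Im_complex_of_real)
qed

section \<open>The centred Poisson law\<close>

text \<open>The Poisson law has density \<open>pmf\<close> with respect to counting measure, so
  expectations are series and integrability is absolute summability.\<close>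

lemma
  fixes f :: "nat \<Rightarrow> 'b::{banach, second_countable_topology}"
  assumes "0 < r" and summable: "summable (\<lambda>n. pmf (poisson_pmf r) n * norm (f n))"
  shows integrable_poisson_pmf: "integrable (poisson_pmf r) f"
    and integral_poisson_pmf: "(\<integral>n. f n \<partial>poisson_pmf r) = (\<Sum>n. pmf (poisson_pmf r) n *\<^sub>R f n)"
proof -
  have int: "integrable (count_space UNIV) (\<lambda>n. pmf (poisson_pmf r) n *\<^sub>R f n)"
    using summable by (simp add: integrable_count_space_nat_iff)
  then show "integrable (poisson_pmf r) f"
    by (simp add: measure_pmf_eq_density integrable_density)
  show "(\<integral>n. f n \<partial>poisson_pmf r) = (\<Sum>n. pmf (poisson_pmf r) n *\<^sub>R f n)"
    using integral_count_space_nat[OF int] by (simp add: measure_pmf_eq_density integral_density)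
qed

text \<open>The cube is dominated by \<open>8 ^ n\<close>, whose Poisson mean is the exponential
  series at 8 up to a factor.\<close>

lemma integrable_centred_poisson_cube: "integrable (poisson_pmf 1) (\<lambda>n. \<bar>real n - 1\<bar> ^ 3)"
proof (rule integrable_poisson_pmf)
  have "summable (\<lambda>n. exp (- 1) * (8 ^ n /\<^sub>R fact n :: real))"
    by (intro summable_mult summable_exp_generic)
  moreover have "\<bar>real n - 1\<bar> ^ 3 \<le> 8 ^ n" for n
  proof -
    have "\<bar>real n - 1\<bar> \<le> 2 ^ n"
      using of_nat_less_two_power[of n, where 'a=real] one_le_power[of "2::real" n] by linarith
    then have "\<bar>real n - 1\<bar> ^ 3 \<le> (2 ^ n) ^ 3" by (intro power_mono) auto
    also have "(2 ^ n) ^ 3 = ((2::real) ^ 3) ^ n"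
      by (simp only: power_mult[symmetric] mult.commute)
    finally show ?thesis by simp
  qed
  ultimately show "summable (\<lambda>n. pmf (poisson_pmf 1) n * norm (\<bar>real n - 1\<bar> ^ 3))"
    by (elim summable_comparison_test'[where N=0]) (simp add: divide_simps power_abs)
qed simp

lemma integrable_centred_poisson: "integrable (poisson_pmf 1) (\<lambda>n. real n - 1)"
  and integral_centred_poisson: "(\<integral>n. real n - 1 \<partial>poisson_pmf 1) = 0"
proof -
  have exp: "(\<lambda>n. 1 / fact n :: real) sums exp 1"
    using exp_converges[of "1::real"] by (simp add: field_simps)
  \<comment> \<open>Cancelling one factor of the factorial turns the shifted series of the mean into
    the exponential series; the dropped term at 0 vanishes.\<close>
  have "(\<lambda>n. real (Suc n) / fact (Suc n)) = (\<lambda>n. 1 / fact n)"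
    by (simp add: fun_eq_iff field_simps del: of_nat_Suc)
  then have "(\<lambda>n. real (Suc n) / fact (Suc n)) sums exp 1"
    using exp by simp
  then have "(\<lambda>n. real n / fact n) sums exp 1"
    using sums_Suc_iff[of "\<lambda>n. real n / fact n" "exp 1"] by simp
  then have "(\<lambda>n. exp (- 1) * (real n / fact n)) sums (exp (- 1) * exp 1)"
    by (rule sums_mult)
  then have sums: "(\<lambda>n. pmf (poisson_pmf 1) n *\<^sub>R real n) sums 1"
    by (simp add: exp_minus field_simps)
  have int: "integrable (poisson_pmf 1) real"
    using sums by (intro integrable_poisson_pmf) (auto dest: sums_summable)
  then show "integrable (poisson_pmf 1) (\<lambda>n. real n - 1)" by simp
  have "(\<integral>n. real n \<partial>poisson_pmf 1) = 1"
    using sums by (subst integral_poisson_pmf) (auto dest: sums_summable simp: sums_iff)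
  with int show "(\<integral>n. real n - 1 \<partial>poisson_pmf 1) = 0" by simp
qed

text \<open>Summing the exponential series in \<open>iexp t\<close> gives
  \<open>exp (iexp t - 1 - \<i> * t)\<close>. The exponent is split into its real part, which
  governs the modulus, and its imaginary part, the phase.\<close>

lemma char_centred_poisson:
  "char (distr (poisson_pmf 1) borel (\<lambda>n. real n - 1)) t = exp (Complex (cos t - 1) (sin t - t))"
proof -
  have exp: "(\<lambda>n. pmf (poisson_pmf 1) n *\<^sub>R iexp (t * (real n - 1)))
      = (\<lambda>n. exp (- 1) * exp (- (\<i> * t)) * (iexp t ^ n /\<^sub>R fact n))"
  proof
    fix n
    have "iexp (t * (real n - 1)) = exp (- (\<i> * t)) * iexp t ^ n"
      by (simp add: exp_of_nat_mult[symmetric] exp_add[symmetric] algebra_simps)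
    then show "pmf (poisson_pmf 1) n *\<^sub>R iexp (t * (real n - 1))
        = exp (- 1) * exp (- (\<i> * t)) * (iexp t ^ n /\<^sub>R fact n)"
      by (simp add: scaleR_conv_of_real field_simps exp_of_real[symmetric])
  qed
  have "summable (\<lambda>n. pmf (poisson_pmf 1) n * norm (iexp (t * (real n - 1))))"
    using summable_mult[OF summable_exp_generic[of "1::real"], of "exp (- 1)"]
    by (simp add: field_simps)
  then have "(\<integral>n. iexp (t * (real n - 1)) \<partial>poisson_pmf 1)
      = (\<Sum>n. pmf (poisson_pmf 1) n *\<^sub>R iexp (t * (real n - 1)))"
    by (rule integral_poisson_pmf[OF zero_less_one])
  then have "char (distr (poisson_pmf 1) borel (\<lambda>n. real n - 1)) t
      = (\<Sum>n. exp (- 1) * exp (- (\<i> * t)) * (iexp t ^ n /\<^sub>R fact n))"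
    unfolding exp by (simp add: char_def integral_distr)
  also have "\<dots> = exp (- 1) * exp (- (\<i> * t)) * exp (iexp t)"
    using sums_mult[OF exp_converges[of "iexp t"], of "exp (- 1) * exp (- (\<i> * t))"]
    by (simp add: sums_iff)
  also have "\<dots> = exp (Complex (cos t - 1) (sin t - t))"
    by (simp add: exp_add[symmetric]) (simp add: complex_eq_iff Re_exp Im_exp cis_conv_exp[symmetric]
      flip: exp_of_real)
  finally show ?thesis .
qed

section \<open>Elementary bounds for sine and cosine\<close>

text \<open>The sine bounds come from \<open>x - x ^ 3 / 6\<close> with error at most
  \<open>x ^ 5 / 120\<close>; the constant 1/7 is a convenient one below 1/6 - 1/120. The cosine
  bound uses the half-angle formula.\<close>

lemma sin_bounds:
  fixes x :: real
  assumes "0 \<le> x" "x \<le> 1"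
  shows "x ^ 3 / 7 \<le> x - sin x" "x - sin x \<le> x\<^sup>2" "1 - cos x \<le> x\<^sup>2" "x / 2 \<le> sin x"
proof -
  have "\<bar>sin x - (\<Sum>m<5. sin_coeff m * x ^ m)\<bar> \<le> inverse (fact 5) * \<bar>x\<bar> ^ 5"
    by (rule Maclaurin_sin_bound)
  moreover have "(\<Sum>m<5. sin_coeff m * x ^ m) = x - x ^ 3 / 6"
    by (simp add: lessThan_nat_numeral sin_coeff_def fact_numeral)
  ultimately have sin: "\<bar>sin x - (x - x ^ 3 / 6)\<bar> \<le> x ^ 5 / 120"
    using assms by (simp add: fact_numeral)
  have "x ^ 5 \<le> x ^ 3" "x ^ 3 \<le> x\<^sup>2" "x\<^sup>2 \<le> x"
    using assms power_decreasing[of 1 2 x] by (auto intro!: power_decreasing)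
  moreover have "0 \<le> x ^ 3" using assms by simp
  ultimately show "x ^ 3 / 7 \<le> x - sin x" "x - sin x \<le> x\<^sup>2" "x / 2 \<le> sin x"
    using sin assms(1) unfolding abs_le_iff by linarith+
  have "1 - cos x = 2 * (sin (x / 2))\<^sup>2"
    using cos_double_sin[of "x / 2"] by simp
  also have "\<dots> \<le> 2 * (x / 2)\<^sup>2"
    using abs_sin_x_le_abs_x[of "x / 2"] by (simp only: abs_le_square_iff)
  also have "\<dots> \<le> x\<^sup>2" by (simp add: power2_eq_square)
  finally show "1 - cos x \<le> x\<^sup>2" .
qed

section \<open>The recursion as a weighted sum\<close>

text \<open>The coefficient of input \<open>j\<close> in the scalar recursion with factors
  \<open>b\<close> and noise scales \<open>s\<close>. Input 0 is the initial value and input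
  \<open>Suc k\<close> the noise of step \<open>k\<close>; only indices \<open>j \<le> k\<close> are
  meaningful.\<close>

primrec weight :: "(nat \<Rightarrow> real) \<Rightarrow> (nat \<Rightarrow> real) \<Rightarrow> nat \<Rightarrow> nat \<Rightarrow> real" where
  "weight b s 0 j = 1"
| "weight b s (Suc k) j = (if j = Suc k then s k else b k * weight b s k j)"

lemma sum_weight_Suc:
  fixes x :: "nat \<Rightarrow> 'a::real_vector"
  shows "(\<Sum>j\<le>Suc k. weight b s (Suc k) j *\<^sub>R x j)
    = b k *\<^sub>R (\<Sum>j\<le>k. weight b s k j *\<^sub>R x j) + s k *\<^sub>R x (Suc k)"
proof -
  have "(\<Sum>j\<le>k. weight b s (Suc k) j *\<^sub>R x j) = (\<Sum>j\<le>k. b k *\<^sub>R weight b s k j *\<^sub>R x j)"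
    by (intro sum.cong) auto
  then show ?thesis by (simp add: scaleR_sum_right)
qed

text \<open>The recursion on the side of characteristic functions: the old product is evaluated at
  the contracted argument \<open>b k * t\<close>, so inductions over \<open>k\<close> have to leave
  \<open>t\<close> free.\<close>

lemma prod_weight_Suc:
  fixes \<phi> :: "real \<Rightarrow> 'a::comm_monoid_mult"
  shows "(\<Prod>j\<le>Suc k. \<phi> (weight b s (Suc k) j * t)) = (\<Prod>j\<le>k. \<phi> (weight b s k j * (b k * t))) * \<phi> (s k * t)"
proof -
  have "(\<Prod>j\<le>k. \<phi> (weight b s (Suc k) j * t)) = (\<Prod>j\<le>k. \<phi> (weight b s k j * (b k * t)))"
    by (intro prod.cong) (auto simp: mult_ac)
  then show ?thesis by simp
qed

text \<open>For \<open>- mat 1\<close> every step matrix is a multiple of the identity. The powers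
  of \<open>k + K\<close> in the step size and in the drift correction multiply to
  \<open>k + K\<close>, which leaves the scalar term \<open>\<xi> / (2 * real (k + K))\<close>. The
  sequence \<open>Y\<close> joins the initial value and the noise, shifted by one.\<close>

lemma iterate_eq_sum_weight:
  fixes X :: "nat \<Rightarrow> 'w \<Rightarrow> real^'n"
  assumes "0 < \<alpha>" "0 < K"
  shows "iterate \<xi> \<alpha> K (- mat 1) (\<lambda>k \<omega>. Y (Suc k) \<omega>) (Y 0) k \<omega>
    = (\<Sum>j\<le>k. weight (\<lambda>k. 1 - step_size \<xi> \<alpha> K k + \<xi> / (2 * real (k + K)))
        (\<lambda>k. sqrt (step_size \<xi> \<alpha> K k)) k j *\<^sub>R (Y j \<omega> :: real^'n))"
proof (induction k)
  case (Suc k)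
  let ?a = "step_size \<xi> \<alpha> K k" and ?n = "real (k + K)"
  have n: "?n > 0" using \<open>0 < K\<close> by simp
  have "?a * (\<xi> / (2 * \<alpha> * ?n powr (1 - \<xi>))) = \<xi> / (2 * (?n powr \<xi> * ?n powr (1 - \<xi>)))"
    using \<open>0 < \<alpha>\<close> n by (simp add: step_size_def field_simps)
  also have "?n powr \<xi> * ?n powr (1 - \<xi>) = ?n"
    using n by (simp add: powr_add[symmetric])
  finally have *: "?a * (\<xi> / (2 * \<alpha> * ?n powr (1 - \<xi>))) = \<xi> / (2 * ?n)" .
  have "mat 1 + ?a *\<^sub>R drift_matrix \<xi> \<alpha> K (- mat 1) k = (1 - ?a + \<xi> / (2 * ?n)) *\<^sub>R (mat 1 :: real^'n^'n)"
    unfolding drift_matrix_def scaleR_add_right scaleR_scaleR * by (simp add: algebra_simps)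
  then show ?case
    by (simp only: iterate.simps sum_weight_Suc Suc)
       (simp add: scaleR_matrix_vector_assoc[symmetric])
qed simp

section \<open>Persistence of the phase\<close>

text \<open>The constants are chosen to reproduce themselves. With \<open>q = sqrt (a k)\<close>,
  contraction costs the lower bound at most \<open>3 * q^2 * (q * t^3 / 21)\<close>, exactly the
  gain \<open>(q * t)^3 / 7\<close> from the new factor. The bounds \<open>2 * t^2\<close> shrink by
  at least the \<open>(q * t)^2\<close> that the new factor may add.\<close>

lemma prod_char_centred_poisson_bounds:
  assumes a: "\<And>k. 0 < a k" "\<And>k. a k \<le> 1" "\<And>k. a (Suc k) \<le> a k"
    and b: "\<And>k. 1 - a k \<le> b k" "\<And>k. b k \<le> 1 - a k / 2" and t: "0 \<le> t" "t \<le> 1"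
  shows "\<exists>u v. (\<Prod>j\<le>k. char (distr (poisson_pmf 1) borel (\<lambda>n. real n - 1)) (weight b (\<lambda>k. sqrt (a k)) k j * t))
      = exp (Complex (- u) (- v)) \<and> 0 \<le> u \<and> u \<le> 2 * t\<^sup>2 \<and> sqrt (a k) * t ^ 3 / 21 \<le> v \<and> v \<le> 2 * t\<^sup>2"
  using t
proof (induction k arbitrary: t)
  case 0
  have "sqrt (a 0) * t ^ 3 / 21 \<le> t - sin t"
  proof -
    have "sqrt (a 0) * t ^ 3 \<le> 1 * t ^ 3"
      using a[of 0] 0 by (intro mult_right_mono) auto
    moreover have "0 \<le> t ^ 3" using 0 by simp
    ultimately show ?thesis using sin_bounds(1)[OF 0] by linarith
  qed
  moreover have "t - sin t \<le> 2 * t\<^sup>2" "1 - cos t \<le> 2 * t\<^sup>2"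
    using sin_bounds(2,3)[OF 0] zero_le_power2[of t] by linarith+
  ultimately show ?case
    by (intro exI[of _ "1 - cos t"] exI[of _ "t - sin t"]) (simp add: char_centred_poisson)
next
  case (Suc k)
  define q where "q = sqrt (a k)"
  have q: "0 < q" "q \<le> 1" "q\<^sup>2 = a k"
    using a(1,2)[of k] by (auto simp: q_def)
  have bk: "1 - q\<^sup>2 \<le> b k" "b k \<le> 1 - q\<^sup>2 / 2" "0 \<le> b k" "b k \<le> 1"
    using b[of k] a(1,2)[of k] q by auto
  have bt: "0 \<le> b k * t" "b k * t \<le> 1"
    using bk Suc.prems by (auto intro: mult_le_one)
  have qt: "0 \<le> q * t" "q * t \<le> 1"
    using q Suc.prems by (auto intro: mult_le_one)
  obtain u v where uv: "(\<Prod>j\<le>k. char (distr (poisson_pmf 1) borel (\<lambda>n. real n - 1))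
        (weight b (\<lambda>k. sqrt (a k)) k j * (b k * t))) = exp (Complex (- u) (- v))"
      "0 \<le> u" "u \<le> 2 * (b k * t)\<^sup>2" "q * (b k * t) ^ 3 / 21 \<le> v" "v \<le> 2 * (b k * t)\<^sup>2"
    using Suc.IH[OF bt] unfolding q_def by blast
  define u' v' where "u' = u + (1 - cos (q * t))" and "v' = v + (q * t - sin (q * t))"
  have "(\<Prod>j\<le>Suc k. char (distr (poisson_pmf 1) borel (\<lambda>n. real n - 1))
      (weight b (\<lambda>k. sqrt (a k)) (Suc k) j * t)) = exp (Complex (- u') (- v'))"
  proof -
    have "exp (Complex (- u) (- v)) * exp (Complex (cos (q * t) - 1) (sin (q * t) - q * t))
        = exp (Complex (- u') (- v'))"
      by (simp add: exp_add[symmetric] u'_def v'_def complex_add algebra_simps)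
    then show ?thesis
      unfolding prod_weight_Suc uv(1) by (simp only: char_centred_poisson q_def)
  qed
  moreover have "0 \<le> u'"
    using uv(2) by (simp add: u'_def add_increasing)
  moreover have "u' \<le> 2 * t\<^sup>2" "v' \<le> 2 * t\<^sup>2"
  proof -
    \<comment> \<open>The upper bound on \<open>b k\<close> enters here: its square is at most
      \<open>1 - q^2 / 2\<close>, which makes room for the new term.\<close>
    have "(b k)\<^sup>2 \<le> b k" using bk by (simp add: power2_eq_square mult_left_le)
    then have "2 * (b k)\<^sup>2 + q\<^sup>2 \<le> 2" using bk by linarith
    then have "(2 * (b k)\<^sup>2 + q\<^sup>2) * t\<^sup>2 \<le> 2 * t\<^sup>2" by (rule mult_right_mono) simp
    then have "2 * (b k * t)\<^sup>2 + (q * t)\<^sup>2 \<le> 2 * t\<^sup>2" by (simp add: algebra_simps)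
    then show "u' \<le> 2 * t\<^sup>2" "v' \<le> 2 * t\<^sup>2"
      unfolding u'_def v'_def using uv(3,5) sin_bounds(2,3)[OF qt] by linarith+
  qed
  moreover have "sqrt (a (Suc k)) * t ^ 3 / 21 \<le> v'"
  proof -
    have "1 - 3 * q\<^sup>2 \<le> (1 - q\<^sup>2) ^ 3"
      using Bernoulli_inequality[of "- q\<^sup>2" 3] q a(2)[of k] by simp
    also have "\<dots> \<le> b k ^ 3"
      using bk q a(2)[of k] by (intro power_mono) auto
    finally have "1 \<le> b k ^ 3 + 3 * q\<^sup>2" by simp
    then have "1 * (q * t ^ 3) \<le> (b k ^ 3 + 3 * q\<^sup>2) * (q * t ^ 3)"
      using q Suc.prems by (intro mult_right_mono) auto
    also have "\<dots> = q * (b k * t) ^ 3 + 3 * (q * t) ^ 3"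
      by (simp add: power_mult_distrib distrib_right) (simp add: power2_eq_square power3_eq_cube)
    finally have "q * t ^ 3 / 21 \<le> v'"
      unfolding v'_def using uv(4) sin_bounds(1)[OF qt] by simp
    \<comment> \<open>Monotone step sizes allow the bound in terms of \<open>a k\<close> to be
      restated with \<open>a (Suc k)\<close>.\<close>
    moreover have "sqrt (a (Suc k)) * t ^ 3 \<le> q * t ^ 3"
      unfolding q_def using a(3)[of k] Suc.prems by (intro mult_right_mono) auto
    ultimately show ?thesis by simp
  qed
  ultimately show ?case by blast
qed

text \<open>At \<open>t = 1/2\<close> both \<open>u\<close> and \<open>v\<close> are at most 1/2, so
  \<open>exp (- u)\<close> stays away from 0 and \<open>sin v \<ge> v / 2\<close> applies. The
  constant 336 is 21 * 8 * 2, from the cubic bound, the cube of \<open>t\<close> and this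
  halving.\<close>

lemma Im_prod_char_centred_poisson:
  assumes "\<And>k. 0 < a k" "\<And>k. a k \<le> 1" "\<And>k. a (Suc k) \<le> a k"
    and "\<And>k. 1 - a k \<le> b k" "\<And>k. b k \<le> 1 - a k / 2"
  shows "exp (- 1 / 2) / 336 * sqrt (a k)
    \<le> \<bar>Im (\<Prod>j\<le>k. char (distr (poisson_pmf 1) borel (\<lambda>n. real n - 1)) (weight b (\<lambda>k. sqrt (a k)) k j * (1 / 2)))\<bar>"
proof -
  obtain u v where uv: "(\<Prod>j\<le>k. char (distr (poisson_pmf 1) borel (\<lambda>n. real n - 1))
        (weight b (\<lambda>k. sqrt (a k)) k j * (1 / 2))) = exp (Complex (- u) (- v))"
      "u \<le> 1 / 2" "sqrt (a k) / 168 \<le> v" "v \<le> 1 / 2"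
    using prod_char_centred_poisson_bounds[where a=a and b=b, OF assms, of "1 / 2" k]
    by (auto simp: power2_eq_square power3_eq_cube)
  have v: "0 \<le> v"
    by (rule order_trans[OF _ uv(3)]) (use assms(1)[of k] in simp)
  have "exp (- 1 / 2) / 336 * sqrt (a k) = exp (- 1 / 2) * (sqrt (a k) / 168 / 2)" by simp
  also have "\<dots> \<le> exp (- u) * sin v"
    using uv v sin_bounds(4)[of v] assms(1)[of k, THEN less_imp_le] by (intro mult_mono) auto
  also have "\<dots> \<le> \<bar>Im (exp (Complex (- u) (- v)))\<bar>"
    by (simp add: Im_exp)
  finally show ?thesis unfolding uv(1) .
qed

section \<open>The noise law and the drift matrix\<close>

lemma axis_eq_scaleR: "axis i x = x *\<^sub>R (axis i 1 :: real^'n)"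
  by (simp add: axis_def vec_eq_iff)

text \<open>Concentration on one axis reduces every dimension to a scalar problem.\<close>

definition centred_poisson :: "'n \<Rightarrow> (real^'n) measure" where
  "centred_poisson i = distr (poisson_pmf 1) borel (\<lambda>n. axis i (real n - 1))"

lemma prob_space_centred_poisson: "prob_space (centred_poisson i)"
  unfolding centred_poisson_def by (intro measure_pmf.prob_space_distr) simp

lemma sets_centred_poisson [simp, measurable_cong]: "sets (centred_poisson i) = sets borel"
  by (simp add: centred_poisson_def)

lemma distr_centred_poisson_component:
  "distr (centred_poisson i) borel (\<lambda>x. x $ i) = distr (poisson_pmf 1) borel (\<lambda>n. real n - 1)"
  unfolding centred_poisson_def by (subst distr_distr) (auto simp: comp_def)

lemma integral_centred_poisson_axis: "(\<integral>x. x \<partial>centred_poisson i) = 0"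
  unfolding centred_poisson_def
  by (subst integral_distr, simp, simp, subst axis_eq_scaleR)
     (simp add: integrable_centred_poisson integral_centred_poisson)

lemma integrable_norm_centred_poisson:
  "integrable (centred_poisson i) (\<lambda>x. norm x ^ 3)" "integrable (centred_poisson i) (\<lambda>x. norm x ^ 2)"
proof -
  interpret prob_space "centred_poisson i" by (rule prob_space_centred_poisson)
  show 3: "integrable (centred_poisson i) (\<lambda>x. norm x ^ 3)"
    using integrable_centred_poisson_cube
    by (simp add: centred_poisson_def integrable_distr_eq axis_eq_scaleR[of i "real _ - 1"])
  \<comment> \<open>The second moment is inherited from the third, by cases on whether the norm
    exceeds 1.\<close>
  have "norm x ^ 2 \<le> 1 + norm x ^ 3" for x :: "real^'n"
  proof (cases "norm x \<le> 1")
    case True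
    then show ?thesis by (simp add: power_le_one add_increasing2)
  next
    case False
    then have "norm x ^ 2 \<le> norm x ^ 3" by (intro power_increasing) auto
    then show ?thesis by simp
  qed
  then show "integrable (centred_poisson i) (\<lambda>x. norm x ^ 2)"
    by (intro Bochner_Integration.integrable_bound[OF Bochner_Integration.integrable_add
          [OF integrable_const[of 1] 3]] AE_I2) simp_all
qed

text \<open>Any nonzero coordinate of an eigenvector forces the eigenvalue to be -1.\<close>

lemma hurwitz_minus_mat_1: "hurwitz (- mat 1 :: real^'n^'n)"
  unfolding hurwitz_def
proof (intro allI impI, elim conjE)
  fix l and v :: "complex^'n"
  assume v: "v \<noteq> 0" and eq: "(\<chi> i j. complex_of_real ((- mat 1 :: real^'n^'n) $ i $ j)) *v v = l *s v"
  have "(\<chi> i j. complex_of_real ((- mat 1 :: real^'n^'n) $ i $ j)) = 0 - mat 1"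
    by (simp add: vec_eq_iff mat_def)
  then have "- v = l *s v"
    using eq by (simp only: matrix_vector_mult_diff_rdistrib) simp
  then have *: "- (v $ j) = l * v $ j" for j
    by (metis vector_smult_component vector_uminus_component)
  obtain j where "v $ j \<noteq> 0"
    using v by (auto simp: vec_eq_iff)
  moreover have "(l + 1) * v $ j = 0"
    using *[of j] by (simp add: distrib_right) (metis left_minus)
  ultimately have "l = - 1"
    by (simp add: add_eq_0_iff2)
  then show "Re l < 0" by simp
qed

section \<open>The instance and its distance from the Gaussian\<close>

text \<open>The hypothesis \<open>\<xi> \<le> \<alpha>\<close> keeps the drift correction \<open>\<xi> / (2 (k + K))\<close> below half the step size; it
  covers both \<open>\<alpha> = 1\<close> with arbitrary \<open>\<xi>\<close> and \<open>\<xi> = 0\<close> with arbitrary \<open>\<alpha>\<close>.\<close>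

lemma gaussian_distance_lower_bound:
  fixes i :: "'n::finite"
    and k :: nat
  defines "M \<equiv> PiM (UNIV :: nat set) (\<lambda>_. centred_poisson i)"
  defines "X \<equiv> \<lambda>k \<omega>. \<omega> (Suc k)" and "z0 \<equiv> \<lambda>\<omega>. \<omega> 0"
  assumes \<xi>: "0 \<le> \<xi>" "\<xi> < 1" and \<alpha>: "0 < \<alpha>" "\<xi> \<le> \<alpha>" "\<alpha> \<le> 1" and K: "2 \<le> K"
  shows "recursion_instance M \<xi> \<alpha> K (- mat 1) X z0"
    and "distr M borel (X k) = centred_poisson i" and "distr M borel z0 = centred_poisson i"
    and "ennreal (exp (- 1 / 2) / 336 * sqrt (step_size \<xi> \<alpha> K k)) \<le> gaussian_distance M \<xi> \<alpha> K (- mat 1) X z0 k"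
proof -
  let ?a = "step_size \<xi> \<alpha> K"
  interpret M: prob_space M
    unfolding M_def by (intro prob_space_PiM prob_space_centred_poisson)
  have component: "distr M borel (\<lambda>\<omega>. \<omega> j) = centred_poisson i" for j
  proof -
    have "distr M borel (\<lambda>\<omega>. \<omega> j) = distr M (centred_poisson i) (\<lambda>\<omega>. \<omega> j)"
      by (rule distr_cong) auto
    then show ?thesis
      unfolding M_def using distr_PiM_component[of UNIV "\<lambda>_. centred_poisson i" j]
      by (simp add: prob_space_centred_poisson)
  qed
  have [measurable]: "(\<lambda>\<omega>. \<omega> j) \<in> borel_measurable M" for j
    unfolding M_def by simp
  show X: "distr M borel (X k) = centred_poisson i" and z0: "distr M borel z0 = centred_poisson i" for k
    unfolding X_def z0_def by (rule component)+
  have n: "1 \<le> real (k + K)" for k using K by simp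
  have a: "0 < ?a k" "?a k \<le> 1" "?a (Suc k) \<le> ?a k" for k
  proof -
    have "1 \<le> real (k + K) powr \<xi>" using n \<xi> by (intro ge_one_powr_ge_zero) auto
    then show "0 < ?a k" "?a k \<le> 1"
      using \<alpha> n[of k] by (auto simp: step_size_def divide_le_eq)
    have "0 < real (k + K) powr \<xi>" using n[of k] by simp
    moreover have "real (k + K) powr \<xi> \<le> real (Suc k + K) powr \<xi>" using \<xi> by (intro powr_mono2) auto
    ultimately show "?a (Suc k) \<le> ?a k"
      unfolding step_size_def using \<alpha> by (intro divide_left_mono mult_pos_pos) auto
  qed
  have b: "1 - ?a k \<le> 1 - ?a k + \<xi> / (2 * real (k + K))"
    "1 - ?a k + \<xi> / (2 * real (k + K)) \<le> 1 - ?a k / 2" for k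
  proof -
    \<comment> \<open>Since \<open>\<xi> \<le> \<alpha>\<close> and the denominator of the step size
      is at most \<open>k + K\<close>, the correction is at most half the step size, as the phase
      bounds require.\<close>
    have "real (k + K) powr \<xi> \<le> real (k + K) powr 1" using n \<xi> by (intro powr_mono) auto
    then have "\<xi> / real (k + K) \<le> ?a k"
      unfolding step_size_def using n[of k] \<alpha> \<xi> by (intro frac_le) auto
    then have "\<xi> / real (k + K) / 2 \<le> ?a k / 2" by (rule divide_right_mono) simp
    then have "\<xi> / (2 * real (k + K)) \<le> ?a k / 2" by (simp add: mult.commute)
    then show "1 - ?a k + \<xi> / (2 * real (k + K)) \<le> 1 - ?a k / 2" by linarith
  qed (use \<xi> in simp)
  have "M.indep_vars (\<lambda>_. centred_poisson i) (\<lambda>j \<omega>. \<omega> j) UNIV"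
    unfolding M_def by (intro indep_vars_PiM_component prob_space_centred_poisson) simp
  then have "M.indep_vars (\<lambda>_. borel) (\<lambda>j \<omega>. \<omega> j) UNIV"
    by (rule M.indep_vars_compose2[where Y="\<lambda>_ x. x"]) (simp add: measurable_ident_sets)
  \<comment> \<open>Prepending \<open>z0\<close> to the shifted coordinates restores the coordinate
    process, whose independence was just shown.\<close>
  moreover have "case_nat z0 X = (\<lambda>j \<omega>. \<omega> j)"
    by (auto simp: fun_eq_iff X_def z0_def split: nat.split)
  moreover have "(\<integral>\<omega>. X 0 \<omega> \<partial>M) = (\<integral>x. x \<partial>distr M borel (X 0))"
    by (subst integral_distr) (auto simp: X_def)
  moreover have "integrable M (\<lambda>\<omega>. norm (X 0 \<omega>) ^ 3)"
    using integrable_norm_centred_poisson(1)[of i] unfolding X[of 0, symmetric]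
    by (subst (asm) integrable_distr_eq) (auto simp: X_def)
  moreover have "integrable M (\<lambda>\<omega>. norm (z0 \<omega>) ^ 2)"
    using integrable_norm_centred_poisson(2)[of i] unfolding z0[symmetric]
    by (subst (asm) integrable_distr_eq) (auto simp: z0_def)
  ultimately show "recursion_instance M \<xi> \<alpha> K (- mat 1) X z0"
    unfolding recursion_instance_def
    using \<alpha> K a X hurwitz_minus_mat_1 M.prob_space_axioms by (simp add: integral_centred_poisson_axis)
  let ?w = "weight (\<lambda>k. 1 - ?a k + \<xi> / (2 * real (k + K))) (\<lambda>k. sqrt (?a k))"
  define z where "z = iterate \<xi> \<alpha> K (- mat 1) X z0 k"
  have z: "z = (\<lambda>\<omega>. \<Sum>j\<le>k. ?w k j *\<^sub>R \<omega> j)"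
    unfolding z_def X_def z0_def
    using iterate_eq_sum_weight[of \<alpha> K \<xi> "\<lambda>j \<omega>. \<omega> j" k] \<alpha> K by auto
  have [measurable]: "z \<in> borel_measurable M"
    unfolding z by measurable
  let ?\<nu> = "distr std_gaussian borel (\<lambda>x. psd_sqrt (covariance_matrix M z) *v x)"
  have "distr (distr M borel z) borel (\<lambda>x. x $ i) = distr M borel (\<lambda>\<omega>. \<Sum>j\<le>k. ?w k j * \<omega> j $ i)"
    by (subst distr_distr) (auto simp: comp_def z)
  then have char: "char (distr (distr M borel z) borel (\<lambda>x. x $ i)) (1 / 2)
      = (\<Prod>j\<le>k. char (distr (poisson_pmf 1) borel (\<lambda>n. real n - 1)) (?w k j * (1 / 2)))"
    unfolding distr_centred_poisson_component[symmetric, of i] M_def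
    by (simp only:) (rule char_weighted_sum_PiM[OF prob_space_centred_poisson, where f="\<lambda>x. x $ i"];
      simp cong: measurable_cong_sets)
  have "prob_space (distr M borel z)"
    by (rule M.prob_space_distr) simp
  moreover have "prob_space ?\<nu>"
    by (rule prob_space.prob_space_distr[OF prob_space_std_gaussian]) (simp add: std_gaussian_def)
  \<comment> \<open>The Gaussian contributes imaginary part 0, so only that of the iterate
    remains.\<close>
  ultimately have "ennreal \<bar>Im (char (distr (distr M borel z) borel (\<lambda>x. x $ i)) (1 / 2))\<bar>
      \<le> wasserstein1 (distr M borel z) ?\<nu>"
    using wasserstein1_ge_Im_char[of "distr M borel z" ?\<nu> "1 / 2" i] by (simp add: Im_char_gaussian_component)
  then show "ennreal (exp (- 1 / 2) / 336 * sqrt (?a k)) \<le> gaussian_distance M \<xi> \<alpha> K (- mat 1) X z0 k"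
    unfolding gaussian_distance_def Let_def z_def[symmetric] char
    using Im_prod_char_centred_poisson[of ?a "\<lambda>k. 1 - ?a k + \<xi> / (2 * real (k + K))" k, OF a b] by (meson ennreal_leI order_trans)
qed

theorem proposition6p1:
  fixes \<xi> :: real
  assumes "0 \<le> \<xi>" and "\<xi> < 1"
  shows "(\<exists>(M :: (nat \<Rightarrow> real^'n) measure) \<alpha> K (H :: real^'n^'n) X z0 c.
            recursion_instance M \<xi> \<alpha> K H X z0 \<and> c > 0 \<and>
            (\<forall>k. ennreal (c * sqrt (step_size \<xi> \<alpha> K k)) \<le> gaussian_distance M \<xi> \<alpha> K H X z0 k))
       \<and> (\<xi> = 0 \<longrightarrow>
           (\<exists>(H :: real^'n^'n) \<mu> \<nu> c. c > 0 \<and>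
             (\<forall>\<^sub>F \<alpha> in at_right 0. \<forall>K\<ge>2.
               \<exists>(M :: (nat \<Rightarrow> real^'n) measure) X z0.
                 recursion_instance M \<xi> \<alpha> K H X z0 \<and>
                 distr M borel (X 0) = \<mu> \<and> distr M borel z0 = \<nu> \<and>
                 (\<forall>k. ennreal (c * sqrt (step_size \<xi> \<alpha> K k)) \<le> gaussian_distance M \<xi> \<alpha> K H X z0 k))))"
proof -
  \<comment> \<open>Any coordinate can serve as the axis carrying the noise.\<close>
  fix i :: 'n
  let ?c = "exp (- 1 / 2) / 336 :: real"
  have c: "?c > 0" by simp
  note instance_\<alpha> = gaussian_distance_lower_bound[OF assms, where i=i]
  have "\<forall>\<^sub>F \<alpha> in at_right (0::real). 0 < \<alpha> \<and> \<alpha> \<le> 1"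
    by (auto simp: eventually_at_right_field intro!: exI[of _ 1])
  then have "\<forall>\<^sub>F \<alpha> in at_right 0. \<forall>K\<ge>2. \<exists>(M :: (nat \<Rightarrow> real^'n) measure) X z0.
      recursion_instance M \<xi> \<alpha> K (- mat 1) X z0 \<and>
      distr M borel (X 0) = centred_poisson i \<and> distr M borel z0 = centred_poisson i \<and>
      (\<forall>k. ennreal (?c * sqrt (step_size \<xi> \<alpha> K k)) \<le> gaussian_distance M \<xi> \<alpha> K (- mat 1) X z0 k)"
    if "\<xi> = 0"
  proof (rule eventually_mono, intro allI impI)
    fix \<alpha> :: real and K :: nat assume "0 < \<alpha> \<and> \<alpha> \<le> 1" "2 \<le> K"
    \<comment> \<open>For \<open>\<xi> = 0\<close> the condition \<open>\<xi> \<le> \<alpha>\<close>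
      is automatic, and neither the noise law nor \<open>?c\<close> depends on
      \<open>\<alpha>\<close> or \<open>K\<close>.\<close>
    then have *: "0 < \<alpha>" "\<xi> \<le> \<alpha>" "\<alpha> \<le> 1" "2 \<le> K" using that by auto
    show "\<exists>(M :: (nat \<Rightarrow> real^'n) measure) X z0. recursion_instance M \<xi> \<alpha> K (- mat 1) X z0 \<and>
      distr M borel (X 0) = centred_poisson i \<and> distr M borel z0 = centred_poisson i \<and>
      (\<forall>k. ennreal (?c * sqrt (step_size \<xi> \<alpha> K k)) \<le> gaussian_distance M \<xi> \<alpha> K (- mat 1) X z0 k)"
      by (intro exI conjI allI) (rule instance_\<alpha>[OF *])+
  qed
  \<comment> \<open>The choice \<open>\<alpha> = 1\<close> meets both
    \<open>\<xi> \<le> \<alpha>\<close> and \<open>\<alpha> \<le> 1\<close> for every admissible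
    \<open>\<xi>\<close>.\<close>
  moreover have "recursion_instance (PiM (UNIV :: nat set) (\<lambda>_. centred_poisson i)) \<xi> 1 2 (- mat 1)
      (\<lambda>k \<omega>. \<omega> (Suc k)) (\<lambda>\<omega>. \<omega> 0)"
    "\<forall>k. ennreal (?c * sqrt (step_size \<xi> 1 2 k)) \<le> gaussian_distance
      (PiM (UNIV :: nat set) (\<lambda>_. centred_poisson i)) \<xi> 1 2 (- mat 1) (\<lambda>k \<omega>. \<omega> (Suc k)) (\<lambda>\<omega>. \<omega> 0) k"
    using instance_\<alpha>[where \<alpha>=1 and K=2] assms by auto
  ultimately show ?thesis
    using c by blast
qed

end
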